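(* Let $A$ be a ring whose additive group $(A,+,\le)$ is totally ordered, let $b,d\in A$ with $0<d$, and set $B=\{b+id: i\in\mathbb{Z}_{\ge0}\}$. Let $k\ge1$ be an integer and let $c_1,\dots,c_{k+1}\in B$ with $b<c_1<\cdots<c_{k+1}$. Put $C=\{c_1,\dots,c_{k+1}\}$ and $D_i=C\setminus\{c_i\}$ for each $i\in\{1,\dots,k+1\}$. Suppose that the following conditions hold: (1) $c_i$ has a decomposition in $B\setminus C$ for each $i\in\{1,\dots,k+1\}$; (2) $b+c_{k+1}=c_{i_0}+c_{j_0}$ for some integers $i_0,j_0\le k$ (indices in $\{1,\dots,k\}$) with $i_0\ne j_0$; (3) $B\gtrdot\Rightarrow_2 B\setminus D_i$ for each $i\in\{1,\dots,k+1\}$. Then $B\gtrdot\Rightarrow_2 B\setminus\{c_1,\dots,c_{k+1}\}$, that is, $\{c_1,\dots,c_{k+1}\}$ is a 2-th sum-factor collapsed subset of $B$.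
   Context: The additive group $(A,+,\le)$ is totally ordered means that $\le$ is a total order on $A$ such that $v_1\le v_2$ implies $v_1+w\le v_2+w$ for all $v_1,v_2,w\in A$; $v<w$ means $v\le w$ and $v\ne w$. Rings are associative and need not be commutative or contain $1$. Here $id$ with $i\in\mathbb{Z}_{\ge0}$ is the $i$-fold sum $d+\cdots+d$. An element $a\in A$ has a decomposition in a subset $S\subset A$ if $a=s_1\cdots s_m$ for some $m\ge1$ and $s_1,\dots,s_m\in S$. For non-empty $S\subset A$, $2S=\{s+s': s,s'\in S\}$. For non-empty subsets $S,T\subset A$, write $S\gtrdot\Rightarrow_2 T$ if $S\supset T$, $2S=2T$, and every $s\in S$ can be written as $s=t_1\cdots t_m$ with $m\ge1$ and $t_1,\dots,t_m\in T$. A subset $C\subset B$ is a 2-th sum-factor collapsed subset of $B$ if $B\setminus C$ is non-empty and $B\gtrdot\Rightarrow_2 B\setminus C$. *)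

theory Defs
  imports Complex_Main "HOL-Library.Set_Algebras"
begin

text \<open>
  A ring whose additive group is totally ordered is a type of sort
  \<open>{ring, linordered_ab_group_add}\<close>. The class \<open>ring\<close> requires neither commutativity
  nor a unit, and this sort imposes no compatibility between the order and multiplication.
\<close>

text \<open>There need not be a unit, so a product \<open>s\<^sub>1 \<cdots> s\<^sub>m\<close> with \<open>m \<ge> 1\<close> starts
  from its first factor \<open>s\<close>; \<open>ss\<close> lists the remaining \<open>m - 1\<close> factors in order.\<close>

definition has_decomposition_in :: "'a::semigroup_mult \<Rightarrow> 'a set \<Rightarrow> bool" where
  "has_decomposition_in a S \<longleftrightarrow> (\<exists>s ss. set (s # ss) \<subseteq> S \<and> a = foldl (*) s ss)"

text \<open>The relation \<open>S \<gtrdot>\<Rightarrow>\<^sub>2 T\<close>; \<open>S + S\<close> is the set of all sums \<open>s + s'\<close>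
  with \<open>s\<close> and \<open>s'\<close> in \<open>S\<close>, not necessarily distinct.\<close>

definition sum_factor_collapses2 :: "'a::ring set \<Rightarrow> 'a set \<Rightarrow> bool" where
  "sum_factor_collapses2 S T \<longleftrightarrow>
     S \<noteq> {} \<and> T \<noteq> {} \<and> T \<subseteq> S \<and> S + S = T + T \<and> (\<forall>s\<in>S. has_decomposition_in s T)"

definition sum_factor_collapsed_subset2 :: "'a::ring set \<Rightarrow> 'a set \<Rightarrow> bool" where
  "sum_factor_collapsed_subset2 C B \<longleftrightarrow>
     C \<subseteq> B \<and> B - C \<noteq> {} \<and> sum_factor_collapses2 B (B - C)"

text \<open>The \<open>i\<close>-fold sum \<open>d + \<cdots> + d\<close> is a constant sum, since without a unit
  \<open>of_nat i * d\<close> is not available.\<close>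

definition arith_progression :: "'a::ring \<Rightarrow> 'a \<Rightarrow> 'a set" where
  "arith_progression b d = {b + (\<Sum>j<i. d) | i::nat. True}"

end

theory Submission imports Defs
begin

text \<open>
  Every element of \<open>B + B\<close> has the form \<open>b + y\<close> with \<open>y \<in> B\<close>; compare \<open>y\<close> with the largest element
  \<open>c (k+1)\<close> of \<open>C\<close>. If \<open>y\<close> is larger, neither \<open>b\<close> nor \<open>y\<close> lies in \<open>C\<close>. If \<open>y\<close> is smaller, the
  representation of \<open>b + y\<close> avoiding \<open>D (k+1)\<close> cannot use \<open>c (k+1)\<close> for reasons of size. If they
  are equal, the representation avoiding \<open>D i0\<close> cannot use \<open>c i0\<close>, because the other summand
  would be \<open>c j0 \<in> D i0\<close>.
\<close>

lemma arith_progression_base: "b \<in> arith_progression b d"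
  unfolding arith_progression_def by (auto intro!: exI[of _ 0])

lemma arith_progression_ge:
  fixes b d :: "'a::{ring, linordered_ab_group_add}"
  assumes "0 \<le> d" "x \<in> arith_progression b d"
  shows "b \<le> x"
  using assms unfolding arith_progression_def by (auto intro: sum_nonneg)

text \<open>With \<open>x\<close> and \<open>y\<close> equal to \<open>b\<close> plus
  \<open>m\<close> and \<open>n\<close> copies of \<open>d\<close>, all \<open>m + n\<close> copies
  can be moved into one summand, leaving the other equal to \<open>b\<close>.\<close>

lemma arith_progression_sum:
  assumes "x \<in> arith_progression b d" "y \<in> arith_progression b d"
  obtains z where "z \<in> arith_progression b d" "x + y = b + z"
proof -
  obtain m n :: nat where x: "x = b + (\<Sum>j<m. d)" and y: "y = b + (\<Sum>j<n. d)"
    using assms unfolding arith_progression_def by blast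
  have "(\<Sum>j<m + n. d) = (\<Sum>j<m. d) + (\<Sum>j<n. d)"
    by (induction n) (simp_all add: add.assoc)
  then have "x + y = b + (b + (\<Sum>j<m + n. d))"
    by (simp add: x y algebra_simps)
  then show thesis
    using that unfolding arith_progression_def by blast
qed

lemma has_decomposition_in_self: "s \<in> S \<Longrightarrow> has_decomposition_in s S"
  unfolding has_decomposition_in_def by (auto intro!: exI[of _ s] exI[of _ "[]"])

theorem theorem2p15:
  fixes b d :: "'a::{ring, linordered_ab_group_add}"
    and B C :: "'a set" and c :: "nat \<Rightarrow> 'a" and D :: "nat \<Rightarrow> 'a set" and k :: nat
  assumes d_pos: "0 < d"
    and B_eq: "B = arith_progression b d"
    and k_pos: "k \<ge> 1"
    and c_in_B: "\<And>i. i \<in> {1..k+1} \<Longrightarrow> c i \<in> B"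
    and b_less: "b < c 1"
    and c_increasing: "\<And>i. i \<in> {1..k} \<Longrightarrow> c i < c (i + 1)"
    and C_eq: "C = c ` {1..k+1}"
    and D_eq: "\<And>i. i \<in> {1..k+1} \<Longrightarrow> D i = C - {c i}"
    and decomposition: "\<And>i. i \<in> {1..k+1} \<Longrightarrow> has_decomposition_in (c i) (B - C)"
    and sum_eq: "\<exists>i0\<in>{1..k}. \<exists>j0\<in>{1..k}. i0 \<noteq> j0 \<and> b + c (k+1) = c i0 + c j0"
    and collapses: "\<And>i. i \<in> {1..k+1} \<Longrightarrow> sum_factor_collapses2 B (B - D i)"
  shows "sum_factor_collapses2 B (B - C) \<and> sum_factor_collapsed_subset2 C B"
proof -
  have c_less: "c i < c j" if "i \<in> {1..k+1}" "j \<in> {1..k+1}" "i < j" for i j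
  proof -
    \<comment> \<open>In this form the induction on \<open>j\<close> starts at a neighbouring pair,
      which \<open>c_increasing\<close> covers.\<close>
    have "Suc i \<le> j" using that by simp
    then show ?thesis using that(2)
    proof (induction j rule: dec_induct)
      case base
      then show ?case using c_increasing[of i] that by simp
    next
      case (step n)
      then have "c n < c (Suc n)" using c_increasing[of n] that by simp
      then show ?case using step by (simp add: less_trans)
    qed
  qed
  let ?M = "c (k+1)"
  have c_le: "x \<le> ?M" if "x \<in> C" for x
    using that c_less[of _ "k+1"] unfolding C_eq by (force simp: le_less)
  have b_notin: "b \<notin> C"
    using b_less c_less[of 1] unfolding C_eq by (force simp: le_less)
  have b_in: "b \<in> B - C"
    using b_notin B_eq arith_progression_base by blast
  have C_B: "C \<subseteq> B" using c_in_B C_eq by blast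
  have avoid: "\<exists>p q. p \<in> B - D i \<and> q \<in> B - D i \<and> x = p + q"
    if "i \<in> {1..k+1}" "x \<in> B + B" for i x
    using collapses[OF that(1)] that(2) unfolding sum_factor_collapses2_def
    by (auto elim!: set_plus_elim)
  \<comment> \<open>Thus a summand supplied by \<open>avoid\<close> lies outside \<open>C\<close> as
    soon as it differs from \<open>c i\<close>.\<close>
  have D_C: "B - C = B - D i - {c i}" if "i \<in> {1..k+1}" for i
    unfolding D_eq[OF that] C_eq using that by blast
  have "B + B \<subseteq> (B - C) + (B - C)"
  proof
    fix x assume xBB: "x \<in> B + B"
    then obtain y where y: "y \<in> B" "x = b + y"
      using arith_progression_sum unfolding B_eq by (metis set_plus_elim)
    consider "y < ?M" | "y = ?M" | "?M < y" by (rule linorder_cases)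
    then show "x \<in> (B - C) + (B - C)"
    proof cases
      case 1
      have i: "k+1 \<in> {1..k+1}" by simp
      obtain p q where pq: "p \<in> B - D (k+1)" "q \<in> B - D (k+1)" "x = p + q"
        using avoid[OF i xBB] by blast
      have "b \<le> z" if "z \<in> B" for z
        using arith_progression_ge[OF less_imp_le[OF d_pos]] that B_eq by simp
      then have "b \<le> p" "b \<le> q" using pq by simp_all
      \<comment> \<open>If one summand were \<open>?M\<close>, the other, being at least
        \<open>b\<close>, would make the sum at least \<open>b + ?M\<close>.\<close>
      then have "p + q < b + ?M \<Longrightarrow> p \<noteq> ?M \<and> q \<noteq> ?M"
        by (auto simp: add.commute)
      then have "p \<in> B - C" "q \<in> B - C"
        using 1 y pq D_C[OF i] by auto
      then show ?thesis using pq(3) by (simp add: set_plus_intro)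
    next
      case 2
      obtain i j where ij: "i \<in> {1..k}" "j \<in> {1..k}" "i \<noteq> j" "b + ?M = c i + c j"
        using sum_eq by blast
      have i: "i \<in> {1..k+1}" and j: "j \<in> {1..k+1}" using ij by auto
      \<comment> \<open>Distinct indices must give distinct values here: otherwise removing
        \<open>c i\<close> from \<open>C\<close> would remove \<open>c j\<close> as well, and
        \<open>c j\<close> would not be in \<open>D i\<close>.\<close>
      have "c i \<noteq> c j"
        using c_less[OF i j] c_less[OF j i] ij(3) by (cases i j rule: linorder_cases) auto
      then have cj: "c j \<in> D i" unfolding D_eq[OF i] C_eq using j by auto
      obtain p q where pq: "p \<in> B - D i" "q \<in> B - D i" "x = p + q"
        using avoid[OF i xBB] by blast
      have eq: "p + q = c i + c j" using pq(3) y(2) 2 ij(4) by simp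
      have "q = c j" if "p = c i" using eq that by simp
      moreover have "p = c j" if "q = c i" using eq that by (simp add: add.commute)
      ultimately have "p \<noteq> c i" "q \<noteq> c i" using cj pq(1,2) by blast+
      then have "p \<in> B - C" "q \<in> B - C"
        using pq D_C[OF i] by auto
      then show ?thesis using pq(3) by (simp add: set_plus_intro)
    next
      case 3
      then have "y \<in> B - C" using c_le[of y] y(1) by auto
      then show ?thesis using y(2) b_in by (simp add: set_plus_intro)
    qed
  qed
  moreover have "(B - C) + (B - C) \<subseteq> B + B"
    by (intro set_plus_mono2) auto
  \<comment> \<open>Elements of \<open>C\<close> decompose by hypothesis; any other element of
    \<open>B\<close> is its own one-factor product.\<close>
  moreover have "has_decomposition_in s (B - C)" if "s \<in> B" for s
    using that decomposition C_eq has_decomposition_in_self[of s "B - C"] by blast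
  ultimately have "sum_factor_collapses2 B (B - C)"
    using b_in unfolding sum_factor_collapses2_def by blast
  then show ?thesis
    using C_B b_in unfolding sum_factor_collapsed_subset2_def by blast
qed

end
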